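(* Let $A\in\mathbb{R}^{n\times n}$ be an irreducible monotone matrix, and let $\{\overline{\lambda}_k\}$, $\{\mathbf{x}_k\}$, $\{\mathbf{y}_{k+1}\}$ be generated by the inexact Noda iteration (INI) applied to $A$ with relaxation factors $0\le\gamma_k\le\gamma<1$ ($\gamma$ a constant), where $\overline{\lambda}_0>\rho(A^{-1})$ and $\mathbf{x}_k\ne\mathbf{x}$ for all $k$. Put $\varepsilon_k=\overline{\lambda}_k-\rho(A^{-1})$ and $$\rho_k=1-(1-\gamma_k)\min\left(\frac{\mathbf{x}_k}{\varepsilon_k\mathbf{y}_{k+1}}\right),$$ so that $\varepsilon_{k+1}=\rho_k\varepsilon_k$. Then $\rho_k\le\frac{2\gamma_k}{1+\gamma_k}<1$. Moreover, if $\gamma_k\le\gamma<1$, then $\lim_{k\to\infty}\rho_k\le\frac{2\gamma}{1+\gamma}<1$, i.e. the convergence of INI is at least globally linear. If $\lim_{k\to\infty}\gamma_k=0$, then $\lim_{k\to\infty}\rho_k=0$, that is, the convergence of INI is globally superlinear.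
   Context: A real square matrix $A$ is monotone if it is nonsingular and $A^{-1}\ge 0$ entrywise. A matrix is reducible if it can be brought to block upper-triangular form by a simultaneous row/column permutation, and irreducible otherwise. $\rho(\cdot)$ (with a matrix argument) is the spectral radius; $\rho_k$ (with index) is the error ratio defined in the claim. $\|\cdot\|$ is the 2-norm for vectors and matrices. $\mathrm{sep}(0,A)=\|A^{-1}\|^{-1}$. For a vector $\mathbf{v}$, $\min(\mathbf{v})$ is its smallest entry, and for positive vectors $\mathbf{v},\mathbf{w}$, $\min\left(\frac{\mathbf{w}}{\mathbf{v}}\right)=\min_i \mathbf{w}^{(i)}/\mathbf{v}^{(i)}$. $\mathbf{x}>0$ denotes the unit-length positive eigenvector of $A^{-1}$ for the simple eigenvalue $\rho(A^{-1})$. Inexact Noda iteration (INI): start with a scalar $\overline{\lambda}_0$ and a vector $\mathbf{x}_0>0$ with $\|\mathbf{x}_0\|=1$. For $k=0,1,2,\dots$: $\mathbf{y}_{k+1}$ is the vector with $(\overline{\lambda}_kA-I)\mathbf{y}_{k+1}=A\mathbf{x}_k+\mathbf{f}_k$, where $\mathbf{f}_k$ is any residual vector with $\|\mathbf{f}_k\|\le\gamma_k\,\mathrm{sep}(0,A)\min(\mathbf{x}_k)$; then $\mathbf{x}_{k+1}=\mathbf{y}_{k+1}/\|\mathbf{y}_{k+1}\|$ and $\overline{\lambda}_{k+1}=\overline{\lambda}_k-(1-\gamma_k)\min\left(\frac{\mathbf{x}_k}{\mathbf{y}_{k+1}}\right)$. The iteration is considered as an infinite sequence, with no stopping test. Global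 linear (resp. superlinear) convergence here means exactly the stated asymptotic bound on the ratios $\rho_k=\varepsilon_{k+1}/\varepsilon_k$.
   Formalization: The bound ρ_k ≤ 2γ_k/(1+γ_k) fails for individual k (for γ_k=0 it would force ρ_k ≤ 0, but ρ_k > 0), so it is stated asymptotically: limsup(ρ_k − 2γ_k/(1+γ_k)) ≤ 0, with ρ_k < 1 for every k; "lim ρ_k ≤ 2γ/(1+γ)" is read as limsup. *)

theory Defs
  imports "HOL-Analysis.Analysis"
begin

definition monotone_matrix :: "real ^ 'n ^ 'n \<Rightarrow> bool" where
  "monotone_matrix A \<longleftrightarrow> invertible A \<and> (\<forall>i j. 0 \<le> matrix_inv A $ i $ j)"

(* The index type 'n carries no order, so the simultaneous row/column permutation is a
   numbering p of the indices by 0, ..., n-1.  After renumbering, the lower left block (rows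
   m, ..., n-1 and columns 0, ..., m-1) vanishes and both diagonal blocks are nonempty. *)
definition reducible_matrix :: "real ^ 'n ^ 'n \<Rightarrow> bool" where
  "reducible_matrix A \<longleftrightarrow>
     (\<exists>(p :: 'n \<Rightarrow> nat) m. bij_betw p UNIV {..<CARD('n)} \<and> 0 < m \<and> m < CARD('n) \<and>
        (\<forall>i j. m \<le> p i \<and> p j < m \<longrightarrow> A $ i $ j = 0))"

definition irreducible_matrix :: "real ^ 'n ^ 'n \<Rightarrow> bool" where
  "irreducible_matrix A \<longleftrightarrow> \<not> reducible_matrix A"

definition complex_eigenvalues :: "real ^ 'n ^ 'n \<Rightarrow> complex set" where
  "complex_eigenvalues B =
     {\<mu>. \<exists>v :: complex ^ 'n. v \<noteq> 0 \<and> (\<chi> i j. complex_of_real (B $ i $ j)) *v v = \<mu> *s v}"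

(* The set of eigenvalues is finite and nonempty, so the supremum is a maximum. *)
definition spectral_radius :: "real ^ 'n ^ 'n \<Rightarrow> real" where
  "spectral_radius B = (SUP \<mu>\<in>complex_eigenvalues B. cmod \<mu>)"

definition matrix_norm2 :: "real ^ 'n ^ 'n \<Rightarrow> real" where
  "matrix_norm2 A = onorm ((*v) A)"

definition sep0 :: "real ^ 'n ^ 'n \<Rightarrow> real" where
  "sep0 A = inverse (matrix_norm2 (matrix_inv A))"

definition positive_vec :: "real ^ 'n \<Rightarrow> bool" where
  "positive_vec v \<longleftrightarrow> (\<forall>i. 0 < v $ i)"

definition min_entry :: "real ^ 'n \<Rightarrow> real" where
  "min_entry v = Min (range (\<lambda>i. v $ i))"

definition min_ratio :: "real ^ 'n \<Rightarrow> real ^ 'n \<Rightarrow> real" where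
  "min_ratio w v = Min (range (\<lambda>i. w $ i / v $ i))"

(* Meaningful for nonnegative irreducible B, where Perron-Frobenius gives existence and
   uniqueness. *)
definition perron_vector :: "real ^ 'n ^ 'n \<Rightarrow> real ^ 'n" where
  "perron_vector B = (THE x. positive_vec x \<and> norm x = 1 \<and> B *v x = spectral_radius B *\<^sub>R x)"

(* lam k is the upper bound on the spectral radius, f k the residual of the inner linear
   system; y 0 is not used. *)
definition inexact_noda_iteration ::
  "real ^ 'n ^ 'n \<Rightarrow> (nat \<Rightarrow> real) \<Rightarrow> (nat \<Rightarrow> real ^ 'n) \<Rightarrow>
     (nat \<Rightarrow> real) \<Rightarrow> (nat \<Rightarrow> real ^ 'n) \<Rightarrow> (nat \<Rightarrow> real ^ 'n) \<Rightarrow> bool" where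
  "inexact_noda_iteration A \<gamma> f lam x y \<longleftrightarrow>
     positive_vec (x 0) \<and> norm (x 0) = 1 \<and>
     (\<forall>k. norm (f k) \<le> \<gamma> k * sep0 A * min_entry (x k) \<and>
          (lam k *\<^sub>R A - mat 1) *v y (Suc k) = A *v x k + f k \<and>
          x (Suc k) = y (Suc k) /\<^sub>R norm (y (Suc k)) \<and>
          lam (Suc k) = lam k - (1 - \<gamma> k) * min_ratio (x k) (y (Suc k)))"

definition noda_error :: "real ^ 'n ^ 'n \<Rightarrow> (nat \<Rightarrow> real) \<Rightarrow> nat \<Rightarrow> real" where
  "noda_error A lam k = lam k - spectral_radius (matrix_inv A)"

definition noda_ratio ::
  "real ^ 'n ^ 'n \<Rightarrow> (nat \<Rightarrow> real) \<Rightarrow> (nat \<Rightarrow> real) \<Rightarrow>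
     (nat \<Rightarrow> real ^ 'n) \<Rightarrow> (nat \<Rightarrow> real ^ 'n) \<Rightarrow> nat \<Rightarrow> real" where
  "noda_ratio A \<gamma> lam x y k =
     1 - (1 - \<gamma> k) * min_ratio (x k) (noda_error A lam k *\<^sub>R y (Suc k))"

end

theory Submission imports Defs begin

text \<open>
  Put \<open>B = A\<^sup>-\<^sup>1\<close>, a nonnegative irreducible matrix, and let \<open>p > 0\<close> and \<open>w > 0\<close> be its right and
  left eigenvectors for the spectral radius \<open>r\<close> (\<open>Perron_pair_exists\<close>, \<open>spectral_radius_eq\<close>).  Multiplication of the
  inner linear system by \<open>B\<close> gives \<open>(lam k - B) y (k+1) = x k + h k\<close>, and the bound on the
  residual is scaled exactly so that \<open>\<bar>h k\<bar> \<le> \<gamma> k * x k\<close> holds entry by entry.  Hence the right-hand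
  side is positive, and the vector \<open>v k = eps k * y (k+1)\<close>, where \<open>eps k = lam k - r\<close>, is positive as
  long as \<open>lam k > r\<close>.  The update of \<open>lam\<close> is chosen to make \<open>B y (k+1) \<le> lam (k+1) y (k+1)\<close>, so
  \<open>lam (k+1) \<ge> r\<close> by the Collatz--Wielandt principle, with equality only at the Perron vector.
  Thus \<open>lam k > r\<close> persists and the error ratio lies strictly between 0 and 1.

  The asymptotics rest on two uniform estimates.  The first is a Harnack inequality
  (\<open>Harnack_subinvariant\<close>): all iterates \<open>x (k+1)\<close> are unit vectors with \<open>B x \<le> lam 0 * x\<close>, and by
  compactness and irreducibility the entries of such vectors are at least a constant \<open>c > 0\<close>.  Pairing
  with \<open>w\<close> shows \<open>w \<bullet> v k = w \<bullet> (x k + h k)\<close>, so \<open>v k\<close> stays bounded although the resolvent blows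
  up; together these two facts keep the error ratios at or below some \<open>q < 1\<close>, and \<open>eps\<close> tends to 0.

  The second is a spectral gap (\<open>spectral_gap\<close>): the distance of \<open>u\<close> from its spectral projection
  onto \<open>p\<close> is at most a constant times the norm of \<open>r u - B u\<close>.  As \<open>r v - B v = eps (x + h - v)\<close>, both \<open>v k\<close>
  and \<open>x (k+1)\<close> are within \<open>O(eps k)\<close> of multiples of \<open>p\<close>.  The multiples compare by
  \<open>w \<bullet> v k \<le> (1 + \<gamma> k) (w \<bullet> x k)\<close>, whence \<open>v k \<le> (1 + \<gamma> k) (1 + O(eps (k-1))) x k\<close> entrywise.  Inserted
  into the definition of the error ratio this is
  \<open>1 - (1 - \<gamma> k) / (1 + \<gamma> k) + O(eps (k-1)) = 2 \<gamma> k / (1 + \<gamma> k) + O(eps (k-1))\<close>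
  (\<open>ratio_asymptotic_bound\<close>), from which all limit statements follow.
\<close>

section \<open>Irreducibility as the absence of zero blocks\<close>

text \<open>
  The numbering in the definition only serves to separate an index set from its complement, so it
  can be recovered from the set of rows alone: number the complement first, then the set.
\<close>

lemma reducible_matrix_iff_zero_block:
  "reducible_matrix B \<longleftrightarrow> (\<exists>S. S \<noteq> {} \<and> S \<noteq> UNIV \<and> (\<forall>i\<in>S. \<forall>j\<in>-S. B $ i $ j = 0))"
  (is "?L \<longleftrightarrow> ?R") for B :: "real ^ 'n ^ 'n"
proof
  assume ?L
  then obtain p :: "'n \<Rightarrow> nat" and m where p: "bij_betw p UNIV {..<CARD('n)}"
    and m: "0 < m" "m < CARD('n)" and z: "\<And>i j. m \<le> p i \<Longrightarrow> p j < m \<Longrightarrow> B $ i $ j = 0"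
    unfolding reducible_matrix_def by blast
  obtain a b where "p a = 0" "p b = m"
    using p m unfolding bij_betw_def by (metis imageE lessThan_iff order_less_trans)
  then have "b \<in> {i. m \<le> p i}" "a \<notin> {i. m \<le> p i}" using m by auto
  then show ?R using z by (intro exI[of _ "{i. m \<le> p i}"]) auto
next
  assume ?R
  then obtain S where S: "S \<noteq> {}" "S \<noteq> UNIV" and z: "\<And>i j. i \<in> S \<Longrightarrow> j \<notin> S \<Longrightarrow> B $ i $ j = 0"
    by auto
  define m where "m = card (- S)"
  have cards: "card S + m = CARD('n)"
    unfolding m_def using card_Un_disjoint[of S "- S"] by (simp add: Compl_partition)
  have m: "0 < m" "m < CARD('n)"
    using S cards card_gt_0_iff[of S] card_gt_0_iff[of "- S"] by (auto simp: m_def)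
  obtain g where g: "bij_betw g (- S) {0..<m}"
    using ex_bij_betw_finite_nat[of "- S"] by (auto simp: m_def)
  obtain h where h: "bij_betw h S {0..<card S}"
    using ex_bij_betw_finite_nat[of S] by auto
  have shift: "bij_betw (\<lambda>i. i + m) {0..<card S} {m..<CARD('n)}"
    using cards by (intro bij_betw_byWitness[where f' = "\<lambda>i. i - m"]) auto
  have hm: "bij_betw (\<lambda>i. h i + m) S {m..<CARD('n)}"
    using bij_betw_trans[OF h shift] by (simp add: o_def)
  let ?p = "\<lambda>i. if i \<in> - S then g i else h i + m"
  have "bij_betw ?p (- S \<union> S) ({0..<m} \<union> {m..<CARD('n)})"
    by (rule bij_betw_disjoint_Un[OF g hm]) auto
  moreover have "{0..<m} \<union> {m..<CARD('n)} = {..<CARD('n)}" using m by auto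
  ultimately have bij: "bij_betw ?p UNIV {..<CARD('n)}" by (simp add: Un_commute)
  have "B $ i $ j = 0" if "m \<le> ?p i" "?p j < m" for i j
  proof (rule z)
    show "i \<in> S" using that(1) bij_betwE[OF g] by (force split: if_splits)
    show "j \<notin> S" using that(2) by auto
  qed
  then show ?L unfolding reducible_matrix_def
    using bij m by blast
qed

lemma irreducible_matrix_nonzero_entry:
  fixes B :: "real ^ 'n ^ 'n"
  assumes "irreducible_matrix B" "S \<noteq> {}" "S \<noteq> UNIV"
  obtains i j where "i \<in> S" "j \<notin> S" "B $ i $ j \<noteq> 0"
  using assms unfolding irreducible_matrix_def reducible_matrix_iff_zero_block by blast

lemma irreducible_matrix_transpose:
  fixes B :: "real ^ 'n ^ 'n"
  assumes "irreducible_matrix B"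
  shows "irreducible_matrix (transpose B)"
  unfolding irreducible_matrix_def reducible_matrix_iff_zero_block
proof
  assume "\<exists>S. S \<noteq> {} \<and> S \<noteq> UNIV \<and> (\<forall>i\<in>S. \<forall>j\<in>-S. transpose B $ i $ j = 0)"
  then obtain S where "S \<noteq> {}" "S \<noteq> UNIV" and z: "\<forall>i\<in>S. \<forall>j\<in>-S. transpose B $ i $ j = 0"
    by blast
  then have "- S \<noteq> {}" "- S \<noteq> UNIV" by auto
  then obtain i j where "i \<in> - S" "j \<notin> - S" "B $ i $ j \<noteq> 0"
    by (rule irreducible_matrix_nonzero_entry[OF assms])
  with z show False by (auto simp: transpose_def)
qed

lemma
  fixes A :: "real ^ 'n ^ 'n"
  assumes "invertible A"
  shows matrix_inv_right: "A ** matrix_inv A = mat 1"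
    and matrix_inv_left: "matrix_inv A ** A = mat 1"
proof -
  have "A ** matrix_inv A = mat 1 \<and> matrix_inv A ** A = mat 1"
    unfolding matrix_inv_def by (rule someI_ex) (use assms in \<open>simp add: invertible_def\<close>)
  then show "A ** matrix_inv A = mat 1" "matrix_inv A ** A = mat 1" by auto
qed

text \<open>
  A zero block of \<open>B = A\<^sup>-\<^sup>1\<close> says that \<open>B\<close> maps the coordinate subspace of vectors vanishing on \<open>S\<close>
  into itself.  As \<open>B\<close> is injective and the dimension is finite, it maps this subspace onto itself;
  therefore \<open>A\<close> preserves it too and has the same zero block.
\<close>

lemma irreducible_matrix_inv:
  fixes A :: "real ^ 'n ^ 'n"
  assumes A: "invertible A" and irr: "irreducible_matrix A"
  shows "irreducible_matrix (matrix_inv A)"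
  unfolding irreducible_matrix_def reducible_matrix_iff_zero_block
proof
  let ?B = "matrix_inv A"
  assume "\<exists>S. S \<noteq> {} \<and> S \<noteq> UNIV \<and> (\<forall>i\<in>S. \<forall>j\<in>-S. ?B $ i $ j = 0)"
  then obtain S where S: "S \<noteq> {}" "S \<noteq> UNIV" and z: "\<forall>i\<in>S. \<forall>j\<in>-S. ?B $ i $ j = 0"
    by blast
  define V where "V = {v :: real ^ 'n. \<forall>i\<in>S. v $ i = 0}"
  have V: "subspace V" by (auto simp: V_def subspace_def)
  have AB: "?B *v (A *v v) = v" "A *v (?B *v v) = v" for v
    using matrix_inv_left[OF A] matrix_inv_right[OF A] by (simp_all add: matrix_vector_mul_assoc)
  have sub: "(*v) ?B ` V \<subseteq> V"
  proof safe
    fix v assume v: "v \<in> V"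
    have "?B $ i $ j * v $ j = 0" if "i \<in> S" for i j
      using z that v by (cases "j \<in> S") (auto simp: V_def)
    then show "?B *v v \<in> V" by (simp add: V_def matrix_vector_mult_def sum.neutral)
  qed
  have "inj_on ((*v) ?B) (span V)" by (metis AB(2) inj_onI)
  then have "dim ((*v) ?B ` V) = dim V" by (intro eucl.dim_image_eq) auto
  then have img: "(*v) ?B ` V = V"
    by (intro eucl.subspace_dim_equal[OF linear_subspace_image V sub]) (auto simp: V)
  have inv: "A *v v \<in> V" if "v \<in> V" for v
  proof -
    have "v \<in> (*v) ?B ` V" unfolding img by (rule that)
    then obtain u where "v = ?B *v u" "u \<in> V" by (rule imageE)
    then show ?thesis by (simp add: AB)
  qed
  have "A $ i $ j = 0" if "i \<in> S" "j \<notin> S" for i j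
  proof -
    have "axis j 1 \<in> V" using that by (auto simp: V_def axis_def)
    from inv[OF this] that(1) show ?thesis
      by (simp add: V_def matrix_vector_mult_basis column_def)
  qed
  with irreducible_matrix_nonzero_entry[OF irr S] show False by blast
qed

section \<open>Positive eigenvectors of nonnegative irreducible matrices\<close>

lemma matrix_vector_mult_mono:
  fixes B :: "real ^ 'n ^ 'm"
  assumes "\<And>i j. 0 \<le> B $ i $ j" "\<And>j. u $ j \<le> v $ j"
  shows "(B *v u) $ i \<le> (B *v v) $ i"
  by (auto simp: matrix_vector_mult_def intro!: sum_mono mult_left_mono assms)

text \<open>
  If \<open>u\<close> vanishes exactly on \<open>S\<close>, then \<open>B u \<le> c u\<close> forces \<open>(B u)\<^sub>i = 0\<close> for \<open>i \<in> S\<close>, and since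
  every term of this sum is nonnegative, the block of \<open>B\<close> from the support of \<open>u\<close> to \<open>S\<close> vanishes.
  Irreducibility leaves only \<open>S = {}\<close>.
\<close>

lemma positive_vec_subinvariant:
  fixes B :: "real ^ 'n ^ 'n"
  assumes B: "\<And>i j. 0 \<le> B $ i $ j" and irr: "irreducible_matrix B"
    and u: "\<And>i. 0 \<le> u $ i" "u \<noteq> 0"
    and sub: "\<And>i. (B *v u) $ i \<le> c * u $ i"
  shows "positive_vec u"
proof (rule ccontr)
  assume "\<not> positive_vec u"
  define S where "S = {i. u $ i = 0}"
  have "S \<noteq> {}" using \<open>\<not> positive_vec u\<close> u(1) 
    by (auto simp: S_def positive_vec_def not_less intro: antisym)
  moreover have "S \<noteq> UNIV" using u(2) by (auto simp: S_def vec_eq_iff)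
  ultimately obtain i j where ij: "i \<in> S" "j \<notin> S" "B $ i $ j \<noteq> 0"
    using irreducible_matrix_nonzero_entry[OF irr] by blast
  have "0 < B $ i $ j * u $ j"
    using ij B[of i j] u(1)[of j] by (auto simp: S_def intro!: mult_pos_pos less_le[THEN iffD2])
  also have "\<dots> \<le> (B *v u) $ i"
    unfolding matrix_vector_mult_def
    by (auto intro!: member_le_sum[where f = "\<lambda>j. B $ i $ j * u $ j"] mult_nonneg_nonneg B u)
  also have "\<dots> \<le> 0" using sub[of i] ij by (simp add: S_def)
  finally show False by simp
qed

lemma sum_coordinates_pos:
  fixes v :: "real ^ 'n"
  assumes "\<And>i. 0 \<le> v $ i" "v \<noteq> 0"
  shows "0 < (\<Sum>i\<in>UNIV. v $ i)"
  using assms by (auto simp: less_le sum_nonneg sum_nonneg_eq_0_iff vec_eq_iff)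

text \<open>
  Brouwer's theorem for \<open>v \<mapsto> B v / (\<Sum>i. (B v)\<^sub>i)\<close> on the standard simplex.  Injectivity of \<open>B\<close> keeps
  the denominator away from 0, and a fixed point is a nonnegative eigenvector, which irreducibility
  makes positive.
\<close>

lemma Perron_eigenvector_exists:
  fixes B :: "real ^ 'n ^ 'n"
  assumes B: "\<And>i j. 0 \<le> B $ i $ j" and irr: "irreducible_matrix B"
    and inj: "\<And>v. B *v v = 0 \<Longrightarrow> v = 0"
  obtains r p where "positive_vec p" "norm p = 1" "B *v p = r *\<^sub>R p"
proof -
  define D where "D = {v :: real ^ 'n. (\<forall>i. 0 \<le> v $ i) \<and> (\<Sum>i\<in>UNIV. v $ i) = 1}"
  define s where "s v = (\<Sum>i\<in>UNIV. (B *v v) $ i)" for v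
  have "closed D" unfolding D_def
    by (intro closed_Collect_conj closed_Collect_all closed_Collect_le closed_Collect_eq
        continuous_intros)
  moreover have "bounded D"
  proof (rule boundedI)
    fix v assume "v \<in> D"
    then show "norm v \<le> 1" using norm_le_l1_cart[of v] by (simp add: D_def)
  qed
  ultimately have "compact D" by (simp add: compact_eq_bounded_closed)
  have "convex D"
    by (auto simp: convex_def D_def sum.distrib simp flip: sum_distrib_left)
  have "axis k 1 \<in> D" for k :: 'n
    by (auto simp: D_def axis_def)
  then have "D \<noteq> {}" by blast
  have nonneg: "0 \<le> (B *v v) $ i" if "v \<in> D" for v i
    using that B by (auto simp: D_def matrix_vector_mult_def intro!: sum_nonneg)
  have s_pos: "0 < s v" if "v \<in> D" for v
  proof -
    have "v \<noteq> 0" using that by (auto simp: D_def)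
    then have "B *v v \<noteq> 0" using inj by blast
    then show ?thesis unfolding s_def using sum_coordinates_pos nonneg[OF that] by blast
  qed
  have "continuous_on D (\<lambda>v. inverse (s v) *\<^sub>R (B *v v))"
    unfolding s_def 
    using s_pos by (intro continuous_intros matrix_vector_mult_linear_continuous_on) (auto simp: s_def less_le)
  moreover have "(\<lambda>v. inverse (s v) *\<^sub>R (B *v v)) \<in> D \<rightarrow> D"
  proof
    fix v assume v: "v \<in> D"
    have "(\<Sum>i\<in>UNIV. (inverse (s v) *\<^sub>R (B *v v)) $ i) = inverse (s v) * s v"
      by (simp add: s_def sum_distrib_left)
    then show "inverse (s v) *\<^sub>R (B *v v) \<in> D"
      using s_pos[OF v] nonneg[OF v] by (auto simp: D_def)
  qed
  ultimately obtain v where v: "v \<in> D" and fp: "inverse (s v) *\<^sub>R (B *v v) = v"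
    using brouwer[OF \<open>compact D\<close> \<open>convex D\<close> \<open>D \<noteq> {}\<close>] by blast
  have eig: "B *v v = s v *\<^sub>R v"
  proof -
    have "s v *\<^sub>R v = (s v * inverse (s v)) *\<^sub>R (B *v v)" by (metis fp scaleR_scaleR)
    then show ?thesis using s_pos[OF v] by simp
  qed
  have "v \<noteq> 0" using v by (auto simp: D_def)
  have "positive_vec v"
    by (rule positive_vec_subinvariant[OF B irr _ \<open>v \<noteq> 0\<close>, of "s v"])
      (use v eig in \<open>auto simp: D_def\<close>)
  show ?thesis
  proof (rule that[of "v /\<^sub>R norm v" "s v"])
    show "positive_vec (v /\<^sub>R norm v)"
      using \<open>positive_vec v\<close> \<open>v \<noteq> 0\<close> by (simp add: positive_vec_def)
    show "norm (v /\<^sub>R norm v) = 1" using \<open>v \<noteq> 0\<close> by simp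
    show "B *v (v /\<^sub>R norm v) = s v *\<^sub>R (v /\<^sub>R norm v)"
      by (simp add: matrix_vector_mult_scaleR eig)
  qed
qed

section \<open>Entrywise ratios and weighted sums\<close>

lemma min_ratio_le: "min_ratio a b \<le> a $ i / b $ i"
  unfolding min_ratio_def by (rule Min_le) auto

lemma min_ratio_attained: obtains i where "min_ratio a b = a $ i / b $ i"
proof -
  have "min_ratio a b \<in> range (\<lambda>i. a $ i / b $ i)"
    unfolding min_ratio_def by (rule Min_in) auto
  then show ?thesis using that by auto
qed

lemma min_ratio_scaleR:
  assumes "0 < c"
  shows "min_ratio a (c *\<^sub>R b) = min_ratio a b / c"
proof (rule antisym)
  obtain i where "min_ratio a b = a $ i / b $ i" by (rule min_ratio_attained)
  then show "min_ratio a (c *\<^sub>R b) \<le> min_ratio a b / c"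
    using min_ratio_le[of a "c *\<^sub>R b" i] by (simp add: mult.commute)
next
  obtain i where "min_ratio a (c *\<^sub>R b) = a $ i / (c *\<^sub>R b) $ i" by (rule min_ratio_attained)
  then show "min_ratio a b / c \<le> min_ratio a (c *\<^sub>R b)"
    using divide_right_mono[OF min_ratio_le[of a b i], of c] assms by (simp add: mult.commute)
qed

lemma inner_positive_vec_pos:
  fixes w u :: "real ^ 'n"
  assumes "positive_vec w" "\<And>i. 0 \<le> u $ i" "u \<noteq> 0"
  shows "0 < w \<bullet> u"
proof -
  obtain k where "u $ k \<noteq> 0" using \<open>u \<noteq> 0\<close> by (auto simp: vec_eq_iff)
  then have "0 < w $ k * u $ k"
    using assms(1) assms(2)[of k] by (simp add: positive_vec_def less_le)
  also have "\<dots> \<le> (\<Sum>i\<in>UNIV. w $ i * u $ i)"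
    using assms by (intro member_le_sum) (auto simp: positive_vec_def less_imp_le)
  finally show ?thesis by (simp add: inner_vec_def)
qed

lemma positive_vec_nonneg: "positive_vec u \<Longrightarrow> 0 \<le> u $ i"
  by (simp add: positive_vec_def less_imp_le)

lemma positive_vec_nonzero: "positive_vec u \<Longrightarrow> u \<noteq> 0"
  by (auto simp: positive_vec_def)

text \<open>
  On the nonnegative orthant a positive weight \<open>w\<close> makes \<open>u \<mapsto> w \<bullet> u\<close> a substitute for the norm.
  It is the useful one here because \<open>w\<close> will be a left eigenvector.
\<close>

lemma norm_le_weighted_sum:
  fixes w :: "real ^ 'n"
  assumes w: "positive_vec w"
  obtains M where "0 < M" "\<And>u. (\<And>i. 0 \<le> u $ i) \<Longrightarrow> norm u \<le> M * (w \<bullet> u)"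
proof
  define m where "m = Min (range (($) w))"
  have "m \<in> range (($) w)" unfolding m_def by (rule Min_in) auto
  then have m: "0 < m" using w by (auto simp: positive_vec_def)
  then show "0 < 1 / m" by simp
  fix u :: "real ^ 'n" assume u: "\<And>i. 0 \<le> u $ i"
  have "m * norm u \<le> m * (\<Sum>i\<in>UNIV. \<bar>u $ i\<bar>)"
    using m norm_le_l1_cart[of u] by simp
  also have "\<dots> = (\<Sum>i\<in>UNIV. m * u $ i)" using u by (simp add: sum_distrib_left)
  also have "\<dots> \<le> (\<Sum>i\<in>UNIV. w $ i * u $ i)"
    using u by (intro sum_mono mult_right_mono) (auto simp: m_def)
  finally show "norm u \<le> 1 / m * (w \<bullet> u)"
    using m by (simp add: field_simps inner_vec_def)
qed

section \<open>Perron--Frobenius theory\<close>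

text \<open>
  The unit vectors \<open>u \<ge> 0\<close> with \<open>B u \<le> L u\<close> form a compact set on which, by irreducibility, every
  coordinate is positive; hence every coordinate has a positive minimum there.
\<close>

lemma Harnack_subinvariant:
  fixes B :: "real ^ 'n ^ 'n"
  assumes B: "\<And>i j. 0 \<le> B $ i $ j" and irr: "irreducible_matrix B"
  obtains c where "0 < c"
    "\<And>u i. (\<And>j. 0 \<le> u $ j) \<Longrightarrow> norm u = 1 \<Longrightarrow> (\<And>j. (B *v u) $ j \<le> L * u $ j) \<Longrightarrow> c \<le> u $ i"
proof -
  define K where "K = {u. (\<forall>j. 0 \<le> u $ j) \<and> norm u = 1 \<and> (\<forall>j. (B *v u) $ j \<le> L * u $ j)}"
  have "closed K" unfolding K_def
    by (intro closed_Collect_conj closed_Collect_all closed_Collect_le closed_Collect_eq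
        continuous_intros matrix_vector_mult_linear_continuous_on)
  moreover have "bounded K" by (rule boundedI[of _ 1]) (simp add: K_def)
  ultimately have "compact K" by (simp add: compact_eq_bounded_closed)
  have bound: "\<exists>c>0. \<forall>u\<in>K. c \<le> u $ i" for i
  proof (cases "K = {}")
    case False
    obtain u where u: "u \<in> K" "\<And>v. v \<in> K \<Longrightarrow> u $ i \<le> v $ i"
      using continuous_attains_inf[OF \<open>compact K\<close> False, of "\<lambda>u. u $ i"]
        continuous_on_component[of K "\<lambda>u. u" i] by auto
    have "u \<noteq> 0" using u(1) by (auto simp: K_def)
    then have "positive_vec u"
      using u(1) by (intro positive_vec_subinvariant[OF B irr, of u L]) (auto simp: K_def)
    then show ?thesis using u(2) by (auto simp: positive_vec_def)
  qed (auto intro: exI[of _ 1])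
  then obtain c where c: "\<And>i. 0 < c i" "\<And>i u. u \<in> K \<Longrightarrow> c i \<le> u $ i" by metis
  have "Min (range c) \<in> range c" by (rule Min_in) auto
  then have "0 < Min (range c)" using c(1) by auto
  moreover have "Min (range c) \<le> u $ i" if "u \<in> K" for u i
    by (rule order_trans[OF Min_le c(2)[OF that, of i]]) auto
  ultimately show ?thesis using that[of "Min (range c)"] by (auto simp: K_def)
qed

text \<open>
  Having the left eigenvector \<open>w\<close> next to \<open>p\<close> turns entrywise inequalities into scalar ones: the
  functional \<open>w \<bullet> _\<close> is monotone and multiplies by \<open>r\<close> under \<open>B\<close>.
\<close>

locale Perron_pair =
  fixes B :: "real ^ 'n ^ 'n" and r :: real and p w :: "real ^ 'n"
  assumes B_nonneg: "\<And>i j. 0 \<le> B $ i $ j" and B_irreducible: "irreducible_matrix B"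
    and p_positive: "positive_vec p" and norm_p: "norm p = 1" and w_positive: "positive_vec w"
    and right_eigen: "B *v p = r *\<^sub>R p" and left_eigen: "w v* B = r *\<^sub>R w"
begin

lemma inner_left_eigen: "w \<bullet> (B *v u) = r * (w \<bullet> u)"
  by (simp add: left_eigen flip: dot_lmul_matrix)

lemma inner_w_mono: "(\<And>i. b $ i \<le> d $ i) \<Longrightarrow> w \<bullet> b \<le> w \<bullet> d"
  by (auto simp: inner_vec_def intro!: sum_mono mult_left_mono positive_vec_nonneg w_positive)

lemma right_eigen_nth: "(B *v p) $ i = r * p $ i"
  by (simp add: right_eigen)

lemma inner_w_p_pos: "0 < w \<bullet> p"
  by (rule inner_positive_vec_pos)
    (simp_all add: w_positive p_positive positive_vec_nonneg positive_vec_nonzero)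

lemma r_nonneg: "0 \<le> r"
proof -
  have "0 \<le> r * p $ i" for i
    unfolding right_eigen_nth[symmetric] matrix_vector_mult_def
    by (auto intro!: sum_nonneg mult_nonneg_nonneg B_nonneg positive_vec_nonneg p_positive)
  moreover have "0 < p $ i" for i using p_positive by (simp add: positive_vec_def)
  ultimately show ?thesis by (meson mult_neg_pos not_less)
qed

text \<open>
  For an eigenvector \<open>v\<close>, the triangle inequality gives \<open>\<bar>\<mu>\<bar> \<bar>v\<bar> \<le> B \<bar>v\<bar>\<close> entrywise; apply \<open>w \<bullet> _\<close>.
\<close>

lemma cmod_eigenvalue_le:
  assumes "\<mu> \<in> complex_eigenvalues B"
  shows "cmod \<mu> \<le> r"
proof -
  obtain v where "v \<noteq> 0" and v: "(\<chi> i j. complex_of_real (B $ i $ j)) *v v = \<mu> *s v"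
    using assms by (auto simp: complex_eigenvalues_def)
  define u where "u = (\<chi> i. cmod (v $ i))"
  have u: "0 \<le> u $ i" for i by (simp add: u_def)
  have "u \<noteq> 0" using \<open>v \<noteq> 0\<close> by (auto simp: u_def vec_eq_iff)
  have "cmod \<mu> * u $ i \<le> (B *v u) $ i" for i
  proof -
    have "cmod \<mu> * u $ i = cmod ((\<mu> *s v) $ i)" by (simp add: u_def norm_mult)
    also have "\<dots> = cmod (\<Sum>j\<in>UNIV. complex_of_real (B $ i $ j) * v $ j)"
      by (simp add: matrix_vector_mult_def flip: v)
    also have "\<dots> \<le> (\<Sum>j\<in>UNIV. B $ i $ j * u $ j)"
      by (rule sum_norm_le) (simp add: norm_mult u_def B_nonneg)
    finally show ?thesis by (simp add: matrix_vector_mult_def)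
  qed
  then have "w \<bullet> (cmod \<mu> *\<^sub>R u) \<le> w \<bullet> (B *v u)" by (intro inner_w_mono) simp
  then have "cmod \<mu> * (w \<bullet> u) \<le> r * (w \<bullet> u)" by (simp add: inner_left_eigen)
  then show ?thesis using inner_positive_vec_pos[OF w_positive u \<open>u \<noteq> 0\<close>] by simp
qed

lemma spectral_radius_eq: "spectral_radius B = r"
proof -
  have "complex_of_real r \<in> complex_eigenvalues B"
    unfolding complex_eigenvalues_def
  proof (intro CollectI exI conjI)
    let ?v = "(\<chi> i. complex_of_real (p $ i))"
    show "?v \<noteq> 0" using positive_vec_nonzero[OF p_positive] by (auto simp: vec_eq_iff)
    show "(\<chi> i j. complex_of_real (B $ i $ j)) *v ?v = complex_of_real r *s ?v"
      using right_eigen_nth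
      by (simp add: vec_eq_iff matrix_vector_mult_def flip: of_real_mult of_real_sum)
  qed
  then have "r \<in> cmod ` complex_eigenvalues B" using r_nonneg by (force simp: image_iff)
  then show ?thesis unfolding spectral_radius_def
    by (intro cSup_eq_maximum) (auto dest: cmod_eigenvalue_le)
qed

text \<open>
  Subtract from \<open>u\<close> the largest multiple of \<open>p\<close> that lies below it.  The difference is a nonnegative
  eigenvector with a zero entry, so it cannot be a nonzero vector.
\<close>

lemma eigenvector_multiple:
  assumes "B *v u = r *\<^sub>R u"
  obtains t where "u = t *\<^sub>R p"
proof -
  define t where "t = min_ratio u p"
  define d where "d = u - t *\<^sub>R p"
  have d: "0 \<le> d $ i" for i
    using min_ratio_le[of u p i] p_positive by (simp add: d_def t_def positive_vec_def field_simps)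
  obtain k where "t = u $ k / p $ k" unfolding t_def by (rule min_ratio_attained)
  then have "d $ k = 0" using p_positive by (simp add: d_def positive_vec_def field_simps less_imp_neq[symmetric])
  have "B *v d = r *\<^sub>R d"
    by (simp add: d_def matrix_vector_mult_diff_distrib matrix_vector_mult_scaleR assms right_eigen
        scaleR_diff_right)
  have "d = 0"
  proof (rule ccontr)
    assume "d \<noteq> 0"
    then have "positive_vec d"
      using \<open>B *v d = r *\<^sub>R d\<close>
      by (intro positive_vec_subinvariant[OF B_nonneg B_irreducible, of d r]) (auto simp: d)
    then show False using \<open>d $ k = 0\<close> unfolding positive_vec_def by (metis less_irrefl)
  qed
  then show ?thesis using that[of t] by (simp add: d_def)
qed

lemma normalized_positive_eigenvector:
  assumes "positive_vec u" "norm u = 1" "B *v u = r *\<^sub>R u"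
  shows "u = p"
proof -
  obtain t where t: "u = t *\<^sub>R p" using eigenvector_multiple[OF assms(3)] .
  have "\<bar>t\<bar> = 1" using assms(2) t by (simp add: norm_p)
  moreover have "0 < t"
    using positive_vec_nonneg[OF p_positive] assms(1) t
    by (auto simp: positive_vec_def zero_less_mult_iff not_less[symmetric])
  ultimately show ?thesis using t by simp
qed

lemma perron_vector_eq: "perron_vector B = p"
  unfolding perron_vector_def spectral_radius_eq
  by (rule the_equality) (auto simp: p_positive norm_p right_eigen normalized_positive_eigenvector)

text \<open>
  A maximum principle: at an index where \<open>u / p\<close> attains its minimum \<open>t\<close>, the hypothesis yields
  \<open>0 < t (c - r) p\<close>, so \<open>t > 0\<close>.
\<close>

lemma resolvent_positive:
  assumes "r < c" and z: "\<And>i. 0 < c * u $ i - (B *v u) $ i"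
  shows "positive_vec u"
proof -
  define t where "t = min_ratio u p"
  have pp: "0 < p $ i" for i using p_positive by (simp add: positive_vec_def)
  have le: "(t *\<^sub>R p) $ i \<le> u $ i" for i
    using min_ratio_le[of u p i] pp[of i] by (simp add: t_def field_simps)
  obtain k where "t = u $ k / p $ k" unfolding t_def by (rule min_ratio_attained)
  then have k: "u $ k = t * p $ k" using pp[of k] by simp
  have "t * (r * p $ k) \<le> (B *v u) $ k"
    using matrix_vector_mult_mono[OF B_nonneg le, of k]
    by (simp add: matrix_vector_mult_scaleR right_eigen)
  then have "0 < t * ((c - r) * p $ k)" using z[of k] k by (simp add: algebra_simps)
  moreover have "0 < (c - r) * p $ k" using \<open>r < c\<close> pp[of k] by simp
  ultimately have "0 < t" by (simp add: zero_less_mult_iff)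
  then have "0 < (t *\<^sub>R p) $ i" for i using pp by simp
  then show ?thesis using le unfolding positive_vec_def by (meson less_le_trans)
qed

lemma Collatz_Wielandt:
  assumes u: "positive_vec u" and sub: "\<And>i. (B *v u) $ i \<le> c * u $ i"
  shows "r \<le> c" and "c = r \<Longrightarrow> B *v u = r *\<^sub>R u"
proof -
  let ?d = "c *\<^sub>R u - B *v u"
  have d: "0 \<le> ?d $ i" for i using sub[of i] by simp
  have eq: "w \<bullet> ?d = (c - r) * (w \<bullet> u)"
    by (simp add: inner_diff_right inner_left_eigen algebra_simps)
  have "0 \<le> w \<bullet> ?d"
    using inner_w_mono[of 0 ?d] d by simp
  moreover have "0 < w \<bullet> u"
    using u by (intro inner_positive_vec_pos) (auto simp: w_positive positive_vec_nonneg positive_vec_nonzero)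
  ultimately show "r \<le> c" by (simp add: eq zero_le_mult_iff)
  assume "c = r"
  then have "w \<bullet> ?d = 0" using eq by simp
  then have "?d = 0" using inner_positive_vec_pos[OF w_positive d] by fastforce
  then show "B *v u = r *\<^sub>R u" using \<open>c = r\<close> by simp
qed

text \<open>
  The complement of the rank-one spectral projection for the eigenvalue \<open>r\<close>.
\<close>

definition perron_defect :: "real ^ 'n \<Rightarrow> real ^ 'n" where
  "perron_defect u = u - ((w \<bullet> u) / (w \<bullet> p)) *\<^sub>R p"

lemma perron_defect_scaleR: "perron_defect (t *\<^sub>R u) = t *\<^sub>R perron_defect u"
  by (simp add: perron_defect_def scaleR_diff_right)

text \<open>
  Simplicity of \<open>r\<close> makes \<open>r - B\<close> injective on the hyperplane orthogonal to \<open>w\<close>, hence bounded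
  below there; and \<open>r - B\<close> sees only the component of \<open>u\<close> in that hyperplane.
\<close>

lemma spectral_gap:
  obtains C where "0 < C" "\<And>u. norm (perron_defect u) \<le> C * norm (r *\<^sub>R u - B *v u)"
proof -
  let ?H = "{u. w \<bullet> u = 0}"
  have lin: "bounded_linear (\<lambda>u. r *\<^sub>R u - B *v u)"
    by (intro bounded_linear_sub bounded_linear_scaleR_right matrix_vector_mul_bounded_linear)
  have "\<forall>u\<in>?H. r *\<^sub>R u - B *v u = 0 \<longrightarrow> u = 0"
  proof safe
    fix u assume u: "w \<bullet> u = 0" "r *\<^sub>R u - B *v u = 0"
    then obtain t where "u = t *\<^sub>R p" using eigenvector_multiple[of u] by auto
    then show "u = 0" using u(1) inner_w_p_pos by auto
  qed
  then obtain e where e: "e > 0" "\<And>u. u \<in> ?H \<Longrightarrow> e * norm u \<le> norm (r *\<^sub>R u - B *v u)"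
    using injective_imp_isometric[OF closed_hyperplane subspace_hyperplane lin, of w] by blast
  show ?thesis
  proof (rule that[of "1 / e"])
    show "0 < 1 / e" using e by simp
    fix u
    have "perron_defect u \<in> ?H"
      using inner_w_p_pos by (simp add: perron_defect_def inner_diff_right)
    moreover have "r *\<^sub>R perron_defect u - B *v perron_defect u = r *\<^sub>R u - B *v u"
      by (simp add: perron_defect_def matrix_vector_mult_diff_distrib matrix_vector_mult_scaleR
          right_eigen scaleR_diff_right)
    ultimately have "e * norm (perron_defect u) \<le> norm (r *\<^sub>R u - B *v u)"
      using e(2) by metis
    then show "norm (perron_defect u) \<le> 1 / e * norm (r *\<^sub>R u - B *v u)"
      using e(1) by (simp add: field_simps)
  qed
qed

end

text \<open>
  The eigenvectors come from \<open>B\<close> and its transpose separately; their eigenvalues agree because both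
  equal the quotient of \<open>w \<bullet> B p\<close> by \<open>w \<bullet> p\<close>.
\<close>

lemma Perron_pair_exists:
  fixes B :: "real ^ 'n ^ 'n"
  assumes B: "\<And>i j. 0 \<le> B $ i $ j" and irr: "irreducible_matrix B" and inv: "invertible B"
  obtains r p w where "Perron_pair B r p w"
proof -
  have inj: "v = 0" if "M *v v = 0" "invertible M" for M :: "real ^ 'n ^ 'n" and v
  proof -
    have "matrix_inv M *v (M *v v) = v"
      by (simp add: matrix_inv_left that(2) matrix_vector_mul_assoc)
    then show ?thesis by (simp add: that(1))
  qed
  obtain r p where p: "positive_vec p" "norm p = 1" "B *v p = r *\<^sub>R p"
    by (rule Perron_eigenvector_exists[OF B irr inj[OF _ inv]])
  have Bt: "0 \<le> transpose B $ i $ j" for i j by (simp add: transpose_def B)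
  have invt: "invertible (transpose B)" using inv by (simp add: invertible_det_nz)
  obtain s w where w: "positive_vec w" "norm w = 1" "transpose B *v w = s *\<^sub>R w"
    by (rule Perron_eigenvector_exists[OF Bt irreducible_matrix_transpose[OF irr] inj[OF _ invt]])
  have "r * (w \<bullet> p) = w \<bullet> (B *v p)" by (simp add: p)
  also have "\<dots> = s * (w \<bullet> p)" using w(3) by (simp flip: dot_lmul_matrix)
  finally have "r = s"
    using inner_positive_vec_pos[OF w(1), of p] p(1) by (simp add: positive_vec_nonneg positive_vec_nonzero)
  show ?thesis
    by (rule that[of r p w]) (use p w B irr \<open>r = s\<close> in \<open>unfold_locales, auto\<close>)
qed

section \<open>One inexact inverse iteration step\<close>

text \<open>
  The current bound is \<open>c\<close>, the current iterate \<open>a\<close>, the relaxation factor \<open>g\<close> and the unnormalized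
  next iterate \<open>u\<close>.  The residual \<open>h\<close> is that of the system after multiplication by \<open>B\<close>.
\<close>

locale inexact_inverse_step = Perron_pair B r p w
  for B :: "real ^ 'n ^ 'n" and r p w +
  fixes c g :: real and a h u :: "real ^ 'n"
  assumes c_gt: "r < c" and g: "0 \<le> g" "g < 1" and a_positive: "positive_vec a"
    and step: "c *\<^sub>R u - B *v u = a + h" and h_le: "\<And>i. \<bar>h $ i\<bar> \<le> g * a $ i"
begin

lemma a_pos: "0 < a $ i"
  using a_positive by (simp add: positive_vec_def)

lemma step_nth: "c * u $ i - (B *v u) $ i = a $ i + h $ i"
  using arg_cong[OF step, of "\<lambda>v. v $ i"] by simp

lemma rhs_ge: "(1 - g) * a $ i \<le> a $ i + h $ i"
  and rhs_le: "a $ i + h $ i \<le> (1 + g) * a $ i"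
  using h_le[of i] by (auto simp: algebra_simps abs_le_iff)

lemma rhs_pos: "0 < a $ i + h $ i"
  by (rule less_le_trans[OF _ rhs_ge]) (use g a_pos in simp)

lemma u_positive: "positive_vec u"
  by (rule resolvent_positive[OF c_gt]) (simp add: step_nth rhs_pos)

lemma u_pos: "0 < u $ i"
  using u_positive by (simp add: positive_vec_def)

lemma min_ratio_pos: "0 < min_ratio a u"
  by (metis min_ratio_attained divide_pos_pos a_pos u_pos)

lemma subinvariant: "(B *v u) $ i \<le> c * u $ i"
  using step_nth[of i] rhs_pos[of i] by simp

text \<open>
  The updated bound still dominates \<open>B u / u\<close>: the right-hand side of the step is at least
  \<open>(1 - g) a\<close>, and \<open>a \<ge> min_ratio a u * u\<close>.
\<close>

lemma subinvariant_next: "(B *v u) $ i \<le> (c - (1 - g) * min_ratio a u) * u $ i"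
proof -
  have "min_ratio a u * u $ i \<le> a $ i"
    using min_ratio_le[of a u i] u_pos[of i] by (simp add: field_simps)
  then have "(1 - g) * (min_ratio a u * u $ i) \<le> (1 - g) * a $ i"
    using g by (intro mult_left_mono) auto
  then show ?thesis using step_nth[of i] rhs_ge[of i] by (simp add: algebra_simps)
qed

text \<open>
  The factor \<open>c - r\<close> cancels the pole of the resolvent at \<open>r\<close>, so that the size of the scaled iterate
  \<open>(c - r) u\<close> is controlled independently of \<open>c\<close>.
\<close>

lemma inner_scaled: "w \<bullet> ((c - r) *\<^sub>R u) = w \<bullet> (a + h)"
  by (simp add: inner_diff_right inner_left_eigen algebra_simps flip: step)

lemma inner_scaled_ge: "(1 - g) * (w \<bullet> a) \<le> w \<bullet> ((c - r) *\<^sub>R u)"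
  unfolding inner_scaled using inner_w_mono[of "(1 - g) *\<^sub>R a" "a + h"] rhs_ge by simp

lemma inner_scaled_le: "w \<bullet> ((c - r) *\<^sub>R u) \<le> (1 + g) * (w \<bullet> a)"
  unfolding inner_scaled using inner_w_mono[of "a + h" "(1 + g) *\<^sub>R a"] rhs_le by simp

lemma residual_scaled:
  "r *\<^sub>R ((c - r) *\<^sub>R u) - B *v ((c - r) *\<^sub>R u) = (c - r) *\<^sub>R (a + h - (c - r) *\<^sub>R u)"
  by (simp add: matrix_vector_mult_scaleR algebra_simps flip: step)

end

section \<open>The inexact Noda iteration\<close>

lemma bound_mono:
  fixes s t :: real
  assumes "0 \<le> s" "s \<le> t"
  shows "2 * s / (1 + s) \<le> 2 * t / (1 + t)"
  using assms by (simp add: divide_simps) (simp add: algebra_simps)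

text \<open>
  The iteration expressed through \<open>B\<close> alone; \<open>h k\<close> stands for \<open>B\<close> times the residual \<open>f k\<close>.
\<close>

locale inexact_Noda = Perron_pair B r p w
  for B :: "real ^ 'n ^ 'n" and r p w +
  fixes g lam :: "nat \<Rightarrow> real" and gmax :: real and x y h :: "nat \<Rightarrow> real ^ 'n"
  assumes g_nonneg: "\<And>k. 0 \<le> g k" and g_le: "\<And>k. g k \<le> gmax" and gmax_less: "gmax < 1"
    and x_0: "positive_vec (x 0)" "norm (x 0) = 1"
    and lam_0: "r < lam 0"
    and not_converged: "\<And>k. x k \<noteq> p"
    and y_Suc: "\<And>k. lam k *\<^sub>R y (Suc k) - B *v y (Suc k) = x k + h k"
    and h_bound: "\<And>k i. \<bar>h k $ i\<bar> \<le> g k * x k $ i"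
    and x_Suc: "\<And>k. x (Suc k) = y (Suc k) /\<^sub>R norm (y (Suc k))"
    and lam_Suc: "\<And>k. lam (Suc k) = lam k - (1 - g k) * min_ratio (x k) (y (Suc k))"
begin

lemma g_less: "g k < 1"
  using g_le gmax_less by (rule le_less_trans)

text \<open>
  Equality \<open>lam (k+1) = r\<close> would make \<open>y (k+1)\<close> an eigenvector and \<open>x (k+1)\<close> the Perron vector, the
  case excluded by \<open>not_converged\<close>.
\<close>

lemma invariant: "r < lam k \<and> positive_vec (x k) \<and> norm (x k) = 1"
proof (induction k)
  case 0
  show ?case using lam_0 x_0 by simp
next
  case (Suc k)
  then interpret st: inexact_inverse_step B r p w "lam k" "g k" "x k" "h k" "y (Suc k)"
    by unfold_locales (auto simp: g_nonneg g_less y_Suc h_bound)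
  let ?u = "y (Suc k)"
  have "?u \<noteq> 0" using st.u_positive by (rule positive_vec_nonzero)
  then have x: "positive_vec (x (Suc k))" "norm (x (Suc k)) = 1"
    using st.u_positive by (auto simp: x_Suc positive_vec_def)
  have sub: "(B *v ?u) $ i \<le> lam (Suc k) * ?u $ i" for i
    unfolding lam_Suc by (rule st.subinvariant_next)
  have "lam (Suc k) \<noteq> r"
  proof
    assume "lam (Suc k) = r"
    then have "B *v ?u = r *\<^sub>R ?u"
      using Collatz_Wielandt(2)[OF st.u_positive sub] by simp
    then have "B *v x (Suc k) = r *\<^sub>R x (Suc k)"
      by (simp add: x_Suc matrix_vector_mult_scaleR)
    then show False using normalized_positive_eigenvector[OF x] not_converged by blast
  qed
  moreover have "r \<le> lam (Suc k)" using Collatz_Wielandt(1)[OF st.u_positive sub] .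
  ultimately show ?case using x by simp
qed

lemma inexact_step: "inexact_inverse_step B r p w (lam k) (g k) (x k) (h k) (y (Suc k))"
  using invariant[of k] by unfold_locales (auto simp: g_nonneg g_less y_Suc h_bound)

sublocale step: inexact_inverse_step B r p w "lam k" "g k" "x k" "h k" "y (Suc k)" for k
  by (rule inexact_step)

definition eps :: "nat \<Rightarrow> real" where
  "eps k = lam k - r"

text \<open>
  The iterate before normalization, rescaled to stay bounded and bounded away from 0 as \<open>eps\<close>
  tends to 0.
\<close>

definition v :: "nat \<Rightarrow> real ^ 'n" where
  "v k = eps k *\<^sub>R y (Suc k)"

definition ratio :: "nat \<Rightarrow> real" where
  "ratio k = 1 - (1 - g k) * min_ratio (x k) (v k)"

lemma eps_pos: "0 < eps k"
  using invariant[of k] by (simp add: eps_def)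

lemma v_pos: "0 < v k $ i"
  using eps_pos step.u_pos by (simp add: v_def)

lemma eps_Suc: "eps (Suc k) = ratio k * eps k"
proof -
  have "eps (Suc k) = eps k - (1 - g k) * min_ratio (x k) (y (Suc k))"
    by (simp add: eps_def lam_Suc)
  then show ?thesis
    using eps_pos[of k] by (simp add: ratio_def v_def min_ratio_scaleR left_diff_distrib[of 1 _ "eps k"])
qed

lemma ratio_pos: "0 < ratio k"
  using eps_Suc[of k] eps_pos[of k] eps_pos[of "Suc k"] by (simp add: zero_less_mult_iff)

lemma ratio_less_1: "ratio k < 1"
proof -
  have "0 < min_ratio (x k) (v k)"
    using step.min_ratio_pos eps_pos by (simp add: v_def min_ratio_scaleR)
  then show ?thesis using g_less[of k] by (simp add: ratio_def)
qed

lemma ratio_le: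
  assumes "\<And>i. v k $ i \<le> b * x k $ i"
  shows "ratio k \<le> 1 - (1 - g k) / b"
proof -
  obtain i where i: "min_ratio (x k) (v k) = x k $ i / v k $ i" by (rule min_ratio_attained)
  have "0 < b * x k $ i" using assms[of i] v_pos[of k i] by simp
  then have "0 < b" using step.a_pos[of k i] by (simp add: zero_less_mult_iff)
  then have "1 / b \<le> min_ratio (x k) (v k)"
    using assms[of i] v_pos[of k i] by (simp add: i field_simps)
  then have "(1 - g k) * (1 / b) \<le> (1 - g k) * min_ratio (x k) (v k)"
    using g_less[of k] by (intro mult_left_mono) auto
  then show ?thesis by (simp add: ratio_def)
qed

lemma decseq_eps: "decseq eps"
  using eps_Suc eps_pos ratio_less_1 by (intro decseq_SucI) (simp add: mult_le_cancel_right1 less_imp_le)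

lemma x_Suc_eq_v: "x (Suc k) = v k /\<^sub>R norm (v k)"
  using eps_pos[of k] by (simp add: x_Suc v_def)

lemma x_nonneg: "0 \<le> x k $ i"
  by (rule less_imp_le[OF step.a_pos])

lemma norm_x: "norm (x k) = 1"
  using invariant by simp

text \<open>
  Since \<open>lam\<close> decreases, all iterates after the initial one satisfy \<open>B x \<le> lam 0 * x\<close>.  Nothing of
  this kind holds for \<open>x 0\<close>, which is why the later estimates concern \<open>x (Suc k)\<close>.
\<close>

lemma x_bounded_below:
  obtains c where "0 < c" "\<And>k i. c \<le> x (Suc k) $ i"
proof -
  obtain c where c: "0 < c"
    "\<And>u i. (\<And>j. 0 \<le> u $ j) \<Longrightarrow> norm u = 1 \<Longrightarrow> (\<And>j. (B *v u) $ j \<le> lam 0 * u $ j) \<Longrightarrow> c \<le> u $ i"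
    using Harnack_subinvariant[OF B_nonneg B_irreducible, of "lam 0"] by metis
  have "(B *v x (Suc k)) $ j \<le> lam 0 * x (Suc k) $ j" for k j
  proof -
    have "(B *v y (Suc k)) $ j \<le> lam k * y (Suc k) $ j" by (rule step.subinvariant)
    also have "\<dots> \<le> lam 0 * y (Suc k) $ j"
      using decseqD[OF decseq_eps, of 0 k] step.u_pos[of k j]
      by (intro mult_right_mono) (auto simp: eps_def)
    finally have "(B *v y (Suc k)) $ j / norm (y (Suc k)) \<le> lam 0 * y (Suc k) $ j / norm (y (Suc k))"
      by (rule divide_right_mono) simp
    then show ?thesis by (simp add: x_Suc matrix_vector_mult_scaleR divide_inverse_commute mult.left_commute)
  qed
  then show ?thesis using that[OF c(1)] c(2) x_nonneg norm_x by blast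
qed

lemma inner_w_v_le: "w \<bullet> v k \<le> (1 + g k) * (w \<bullet> x k)"
  and inner_w_v_ge: "(1 - g k) * (w \<bullet> x k) \<le> w \<bullet> v k"
  using step.inner_scaled_le step.inner_scaled_ge by (simp_all add: v_def eps_def)

lemma inner_w_x_le: "w \<bullet> x k \<le> norm w"
  using norm_cauchy_schwarz[of w "x k"] by (simp add: norm_x)

text \<open>
  The value \<open>w \<bullet> v k\<close> lies between \<open>(1 - g k) (w \<bullet> x k)\<close> and \<open>(1 + g k) (w \<bullet> x k)\<close>, and for positive
  vectors \<open>w \<bullet> _\<close> is equivalent to the norm.  The uniform bound \<open>gmax < 1\<close> keeps the lower estimate
  from degenerating.
\<close>

lemma v_bounded:
  obtains m M where "0 < m" "0 < M" "\<And>k. m \<le> norm (v k)" "\<And>k. norm (v k) \<le> M"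
proof -
  obtain K where K: "0 < K" "\<And>u. (\<And>i. 0 \<le> u $ i) \<Longrightarrow> norm u \<le> K * (w \<bullet> u)"
    using norm_le_weighted_sum[OF w_positive] by metis
  have w: "0 < norm w" using positive_vec_nonzero[OF w_positive] by simp
  show ?thesis
  proof (rule that[of "(1 - gmax) / (K * norm w)" "K * (2 * norm w)"])
    show "0 < (1 - gmax) / (K * norm w)" using gmax_less K(1) w by simp
    show "0 < K * (2 * norm w)" using K(1) w by simp
    fix k
    have "1 \<le> K * (w \<bullet> x k)" using K(2)[of "x k"] by (simp add: x_nonneg norm_x)
    then have "1 / K \<le> w \<bullet> x k" using K(1) by (simp add: field_simps)
    then have "(1 - gmax) * (1 / K) \<le> (1 - g k) * (w \<bullet> x k)"
      using g_le[of k] gmax_less K(1) by (intro mult_mono) auto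
    also have "\<dots> \<le> w \<bullet> v k" by (rule inner_w_v_ge)
    also have "\<dots> \<le> norm w * norm (v k)" by (rule norm_cauchy_schwarz)
    finally show "(1 - gmax) / (K * norm w) \<le> norm (v k)"
      using w K(1) by (simp add: field_simps)
    have "norm (v k) \<le> K * (w \<bullet> v k)" using K(2) v_pos by (simp add: less_imp_le)
    also have "w \<bullet> v k \<le> (1 + g k) * (w \<bullet> x k)" by (rule inner_w_v_le)
    also have "\<dots> \<le> 2 * norm w"
      using g_less[of k] g_nonneg[of k] inner_w_x_le[of k] \<open>1 / K \<le> w \<bullet> x k\<close> K(1)
      by (intro mult_mono) (auto intro: order_trans[of _ "1 / K"])
    finally show "norm (v k) \<le> K * (2 * norm w)" using K(1) by simp
  qed
qed

text \<open>
  Apply the spectral gap to \<open>r v - B v = eps (x + h - v)\<close>, whose last factor is bounded.  The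
  estimate passes to \<open>x (k+1)\<close>, which is \<open>v k\<close> divided by a norm bounded away from 0.
\<close>

lemma perron_defect_bound:
  obtains C where "0 < C" "\<And>k. norm (perron_defect (v k)) \<le> C * eps k"
    "\<And>k. norm (perron_defect (x (Suc k))) \<le> C * eps k"
proof -
  obtain m M where mM: "0 < m" "0 < M" "\<And>k. m \<le> norm (v k)" "\<And>k. norm (v k) \<le> M"
    by (rule v_bounded) blast
  obtain C where C: "0 < C" "\<And>u. norm (perron_defect u) \<le> C * norm (r *\<^sub>R u - B *v u)"
    by (rule spectral_gap) blast
  have h: "norm (h k) \<le> 1" for k
  proof -
    have "g k * x k $ i \<le> 1 * x k $ i" for i
      using g_less[of k] x_nonneg[of k i] by (intro mult_right_mono) auto
    then have "norm (h k) \<le> norm (x k)"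
      using h_bound[of k] x_nonneg[of k]
      by (intro norm_le_componentwise_cart) (auto intro: order_trans)
    then show ?thesis by (simp add: norm_x)
  qed
  have v: "norm (perron_defect (v k)) \<le> C * (2 + M) * eps k" for k
  proof -
    have "norm (x k + h k - v k) \<le> 2 + M"
      using norm_triangle_ineq4[of "x k + h k" "v k"] norm_triangle_ineq[of "x k" "h k"]
        h[of k] norm_x[of k] mM(4)[of k] by linarith
    then have "eps k * norm (x k + h k - v k) \<le> eps k * (2 + M)"
      using eps_pos[of k] by simp
    then have "norm (r *\<^sub>R v k - B *v v k) \<le> eps k * (2 + M)"
      using step.residual_scaled[of k] eps_pos[of k] by (simp add: v_def eps_def)
    then have "C * norm (r *\<^sub>R v k - B *v v k) \<le> C * (eps k * (2 + M))"
      using C(1) by simp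
    then show ?thesis using C(2)[of "v k"] by (simp add: mult_ac)
  qed
  let ?K = "C * (2 + M)"
  have K: "0 < ?K" using C(1) mM(2) by simp
  show ?thesis
  proof (rule that[of "?K * (1 + 1 / m)"])
    show "0 < ?K * (1 + 1 / m)" using mM(1) by (intro mult_pos_pos[OF K]) (simp add: add_pos_pos)
    fix k
    have pos: "0 \<le> ?K * eps k" by (rule less_imp_le[OF mult_pos_pos[OF K eps_pos]])
    have split: "?K * (1 + 1 / m) * eps k = ?K * eps k + ?K * eps k / m"
      by (simp add: algebra_simps add_divide_distrib)
    have "0 \<le> ?K * eps k / m" using pos mM(1) by simp
    then show "norm (perron_defect (v k)) \<le> ?K * (1 + 1 / m) * eps k"
      unfolding split using v[of k] by linarith
    have "norm (perron_defect (x (Suc k))) = norm (perron_defect (v k)) / norm (v k)"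
      by (simp add: x_Suc_eq_v perron_defect_scaleR divide_inverse_commute)
    also have "\<dots> \<le> ?K * eps k / m"
      using v[of k] mM(1) mM(3)[of k] pos by (intro frac_le) auto
    finally show "norm (perron_defect (x (Suc k))) \<le> ?K * (1 + 1 / m) * eps k"
      unfolding split using pos by linarith
  qed
qed

text \<open>
  Entries of \<open>x (k+1)\<close> are at least \<open>c\<close> and those of \<open>v (k+1)\<close> at most \<open>M\<close>, so their quotients are at
  least \<open>c / M\<close>.  This bounds the error ratio by a constant \<open>q < 1\<close> from the second step on.
\<close>

lemma eps_tendsto_0: "eps \<longlonglongrightarrow> 0"
proof -
  obtain c where c: "0 < c" "\<And>k i. c \<le> x (Suc k) $ i" by (rule x_bounded_below) blast
  obtain m M where M: "0 < M" "\<And>k. norm (v k) \<le> M" by (rule v_bounded) blast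
  define q where "q = 1 - (1 - gmax) / (M / c)"
  have q: "ratio (Suc k) \<le> q" for k
  proof -
    have "v (Suc k) $ i \<le> M / c * x (Suc k) $ i" for i
    proof -
      have "v (Suc k) $ i \<le> M" 
        using component_le_norm_cart[of "v (Suc k)" i] M(2)[of "Suc k"] by linarith
      also have "M = M / c * c" using c(1) by simp
      also have "\<dots> \<le> M / c * x (Suc k) $ i"
        using c M(1) by (intro mult_left_mono) auto
      finally show ?thesis .
    qed
    then have "ratio (Suc k) \<le> 1 - (1 - g (Suc k)) / (M / c)" by (rule ratio_le)
    also have "\<dots> \<le> q"
      unfolding q_def using g_le[of "Suc k"] c(1) M(1) by (intro diff_left_mono divide_right_mono) auto
    finally show ?thesis .
  qed
  have "0 \<le> q" using q[of 0] ratio_pos[of "Suc 0"] by linarith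
  have "q < 1" using gmax_less c(1) M(1) by (simp add: q_def)
  have le: "eps (Suc k) \<le> q ^ k * eps 1" for k
  proof (induction k)
    case (Suc k)
    have "eps (Suc (Suc k)) \<le> q * eps (Suc k)"
      unfolding eps_Suc[of "Suc k"] using q[of k] eps_pos[of "Suc k"] by (intro mult_right_mono) auto
    also have "\<dots> \<le> q * (q ^ k * eps 1)" using Suc \<open>0 \<le> q\<close> by (rule mult_left_mono)
    finally show ?case by (simp add: mult.assoc)
  qed simp
  have "(\<lambda>k. q ^ k * eps 1) \<longlonglongrightarrow> 0"
    using LIMSEQ_power_zero[of q] \<open>0 \<le> q\<close> \<open>q < 1\<close> by (auto intro: tendsto_mult_left_zero)
  then have "(\<lambda>k. eps (Suc k)) \<longlonglongrightarrow> 0"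
    by (rule tendsto_sandwich[OF always_eventually always_eventually tendsto_const, rotated 2])
      (use le eps_pos less_imp_le in auto)
  then show ?thesis by (simp add: filterlim_sequentially_Suc)
qed

text \<open>
  Both \<open>v (k+1)\<close> and \<open>x (k+1)\<close> are multiples of \<open>p\<close> up to \<open>O(eps k)\<close>, with coefficients whose quotient is
  at most \<open>1 + g (k+1)\<close>.  The additive error becomes a relative one because the entries of
  \<open>x (k+1)\<close> are at least \<open>c\<close>.
\<close>

lemma ratio_asymptotic_bound:
  obtains Q where "\<And>k. ratio (Suc k) \<le> 2 * g (Suc k) / (1 + g (Suc k)) + Q * eps k"
proof -
  obtain c where c: "0 < c" "\<And>k i. c \<le> x (Suc k) $ i" by (rule x_bounded_below) blast
  obtain C where C: "0 < C" "\<And>k. norm (perron_defect (v k)) \<le> C * eps k"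
    "\<And>k. norm (perron_defect (x (Suc k))) \<le> C * eps k"
    by (rule perron_defect_bound) blast
  define Q where "Q = 2 * C / c"
  have "0 < Q" using c(1) C(1) by (simp add: Q_def)
  show ?thesis
  proof (rule that[of Q])
    fix k
    let ?g = "g (Suc k)" and ?x = "x (Suc k)" and ?v = "v (Suc k)" and ?e = "C * eps k"
    have e: "0 < ?e" using C(1) eps_pos by simp
    have g: "0 \<le> ?g" "?g < 1" by (rule g_nonneg g_less)+
    have "?v $ i \<le> (1 + ?g) * (1 + Q * eps k) * ?x $ i" for i
    proof -
      have pi: "0 < p $ i" using p_positive by (simp add: positive_vec_def)
      have coord: "\<bar>u $ i - (w \<bullet> u) / (w \<bullet> p) * p $ i\<bar> \<le> norm (perron_defect u)" for u
        using component_le_norm_cart[of "perron_defect u" i] by (simp add: perron_defect_def)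
      have "C * eps (Suc k) \<le> ?e"
        using decseqD[OF decseq_eps, of k "Suc k"] C(1) by simp
      then have "?v $ i \<le> (w \<bullet> ?v) / (w \<bullet> p) * p $ i + ?e"
        using coord[of ?v] C(2)[of "Suc k"] by linarith
      also have "(w \<bullet> ?v) / (w \<bullet> p) * p $ i \<le> ((1 + ?g) * (w \<bullet> ?x)) / (w \<bullet> p) * p $ i"
        using inner_w_v_le[of "Suc k"] inner_w_p_pos pi
        by (intro mult_right_mono divide_right_mono) auto
      also have "\<dots> = (1 + ?g) * ((w \<bullet> ?x) / (w \<bullet> p) * p $ i)" by simp
      also have "\<dots> \<le> (1 + ?g) * (?x $ i + ?e)"
        using coord[of ?x] C(3)[of k] g by (intro mult_left_mono) auto
      also have "\<dots> + ?e \<le> (1 + ?g) * (?x $ i + ?e) + (1 + ?g) * ?e"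
        using mult_right_mono[of 1 "1 + ?g" ?e] g e by simp
      also have "\<dots> = (1 + ?g) * (?x $ i + 2 * ?e)" by (simp add: algebra_simps)
      also have "\<dots> \<le> (1 + ?g) * ((1 + Q * eps k) * ?x $ i)"
      proof (rule mult_left_mono)
        have "2 * ?e = Q * eps k * c" using c(1) by (simp add: Q_def)
        also have "\<dots> \<le> Q * eps k * ?x $ i"
          using c(2) \<open>0 < Q\<close> eps_pos[of k] by (intro mult_left_mono) auto
        finally show "?x $ i + 2 * ?e \<le> (1 + Q * eps k) * ?x $ i" by (simp add: algebra_simps)
      qed (use g in simp)
      finally show ?thesis by (simp add: mult.assoc)
    qed
    then have "ratio (Suc k) \<le> 1 - (1 - ?g) / ((1 + ?g) * (1 + Q * eps k))" by (rule ratio_le)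
    also have "\<dots> \<le> 2 * ?g / (1 + ?g) + Q * eps k"
    proof -
      define t where "t = Q * eps k"
      have t: "0 < t" using \<open>0 < Q\<close> eps_pos[of k] by (simp add: t_def)
      have "(1 - ?g) / (1 + ?g) * (1 - 1 / (1 + t)) \<le> 1 * t"
        using g t by (intro mult_mono) (auto simp: field_simps)
      moreover have "1 - (1 - ?g) / ((1 + ?g) * (1 + t)) - 2 * ?g / (1 + ?g)
          = (1 - ?g) / (1 + ?g) * (1 - 1 / (1 + t))"
        using g t by (simp add: field_simps add_nonneg_eq_0_iff)
      ultimately show ?thesis by (simp add: t_def)
    qed
    finally show "ratio (Suc k) \<le> 2 * ?g / (1 + ?g) + Q * eps k" .
  qed
qed

lemma limsup_ratio_minus_bound:
  "limsup (\<lambda>k. ereal (ratio k - 2 * g k / (1 + g k))) \<le> 0"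
proof -
  obtain Q where Q: "\<And>k. ratio (Suc k) \<le> 2 * g (Suc k) / (1 + g (Suc k)) + Q * eps k"
    by (rule ratio_asymptotic_bound) blast
  have "(\<lambda>k. ereal (Q * eps k)) \<longlonglongrightarrow> ereal 0"
    using tendsto_mult_right_zero[OF eps_tendsto_0] by (intro tendsto_ereal) auto
  then have "limsup (\<lambda>k. ereal (Q * eps k)) = 0" 
    by (simp add: lim_imp_Limsup zero_ereal_def)
  moreover have "limsup (\<lambda>k. ereal (ratio k - 2 * g k / (1 + g k)))
      = limsup (\<lambda>k. ereal (ratio (Suc k) - 2 * g (Suc k) / (1 + g (Suc k))))"
    using limsup_shift[of "\<lambda>k. ereal (ratio k - 2 * g k / (1 + g k))"] by simp
  moreover have "\<dots> \<le> limsup (\<lambda>k. ereal (Q * eps k))"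
    by (rule Limsup_mono, rule always_eventually) (use Q in \<open>simp add: algebra_simps\<close>)
  ultimately show ?thesis by simp
qed

lemma limsup_ratio: "limsup (\<lambda>k. ereal (ratio k)) \<le> ereal (2 * gmax / (1 + gmax))"
proof -
  let ?b = "\<lambda>s :: real. 2 * s / (1 + s)"
  have "limsup (\<lambda>k. ereal (ratio k)) \<le> limsup (\<lambda>k. ereal (ratio k - ?b (g k)) + ereal (?b gmax))"
  proof (rule Limsup_mono, rule always_eventually, rule)
    fix k
    show "ereal (ratio k) \<le> ereal (ratio k - ?b (g k)) + ereal (?b gmax)"
      using bound_mono[OF g_nonneg g_le, of k] by simp
  qed
  also have "\<dots> \<le> limsup (\<lambda>k. ereal (ratio k - ?b (g k))) + limsup (\<lambda>k. ereal (?b gmax))"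
    by (rule ereal_limsup_add_mono)
  also have "\<dots> \<le> 0 + ereal (?b gmax)"
    by (intro add_mono limsup_ratio_minus_bound) (simp add: Limsup_const)
  finally show ?thesis by simp
qed

lemma ratio_tendsto_0:
  assumes "g \<longlonglongrightarrow> 0"
  shows "ratio \<longlonglongrightarrow> 0"
proof -
  obtain Q where Q: "\<And>k. ratio (Suc k) \<le> 2 * g (Suc k) / (1 + g (Suc k)) + Q * eps k"
    by (rule ratio_asymptotic_bound) blast
  have "(\<lambda>k. g (Suc k)) \<longlonglongrightarrow> 0" using assms by (rule LIMSEQ_Suc)
  then have "(\<lambda>k. 2 * g (Suc k) / (1 + g (Suc k)) + Q * eps k) \<longlonglongrightarrow> 2 * 0 / (1 + 0) + Q * 0"
    by (intro tendsto_intros eps_tendsto_0) auto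
  then have lim: "(\<lambda>k. 2 * g (Suc k) / (1 + g (Suc k)) + Q * eps k) \<longlonglongrightarrow> 0" by simp
  have "(\<lambda>k. ratio (Suc k)) \<longlonglongrightarrow> 0"
    by (rule tendsto_sandwich[OF _ _ tendsto_const lim])
      (auto intro!: always_eventually less_imp_le[OF ratio_pos] Q)
  then show ?thesis by (simp add: filterlim_sequentially_Suc)
qed

end

section \<open>Convergence of the inexact Noda iteration\<close>

theorem theorem4:
  fixes A :: "real ^ 'n ^ 'n"
    and \<gamma> lam :: "nat \<Rightarrow> real" and \<gamma>max :: real
    and f x y :: "nat \<Rightarrow> real ^ 'n"
  assumes "irreducible_matrix A" and "monotone_matrix A"
    and "\<And>k. 0 \<le> \<gamma> k" and "\<And>k. \<gamma> k \<le> \<gamma>max" and "\<gamma>max < 1"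
    and "inexact_noda_iteration A \<gamma> f lam x y"
    and "lam 0 > spectral_radius (matrix_inv A)"
    and "\<And>k. x k \<noteq> perron_vector (matrix_inv A)"
  shows "(\<forall>k. noda_error A lam (Suc k) = noda_ratio A \<gamma> lam x y k * noda_error A lam k) \<and>
    (\<forall>k. noda_ratio A \<gamma> lam x y k < 1 \<and> 2 * \<gamma> k / (1 + \<gamma> k) < 1) \<and>
    limsup (\<lambda>k. ereal (noda_ratio A \<gamma> lam x y k - 2 * \<gamma> k / (1 + \<gamma> k))) \<le> 0 \<and>
    limsup (\<lambda>k. ereal (noda_ratio A \<gamma> lam x y k)) \<le> ereal (2 * \<gamma>max / (1 + \<gamma>max)) \<and>
    2 * \<gamma>max / (1 + \<gamma>max) < 1 \<and>
    (\<gamma> \<longlonglongrightarrow> 0 \<longrightarrow> noda_ratio A \<gamma> lam x y \<longlonglongrightarrow> 0)"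
proof -
  let ?B = "matrix_inv A"
  have A: "invertible A" and B: "\<And>i j. 0 \<le> ?B $ i $ j"
    using assms(2) by (auto simp: monotone_matrix_def)
  have BA: "?B *v (A *v u) = u" for u
    by (simp add: matrix_vector_mul_assoc matrix_inv_left[OF A])
  have invB: "invertible ?B"
    using matrix_inv_left[OF A] matrix_inv_right[OF A] by (auto simp: invertible_def)
  obtain r p w where "Perron_pair ?B r p w"
    by (rule Perron_pair_exists[OF B irreducible_matrix_inv[OF A assms(1)] invB])
  then interpret Perron_pair ?B r p w .
  note ini = assms(6)[unfolded inexact_noda_iteration_def]
  have step: "lam k *\<^sub>R y (Suc k) - ?B *v y (Suc k) = x k + ?B *v f k" for k
  proof -
    have "(lam k *\<^sub>R A - mat 1) *v y (Suc k) = A *v x k + f k" using ini by blast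
    then have "?B *v (lam k *\<^sub>R (A *v y (Suc k)) - y (Suc k)) = ?B *v (A *v x k + f k)"
      by (simp add: matrix_vector_mult_diff_rdistrib scaleR_matrix_vector_assoc)
    then show ?thesis
      by (simp add: matrix_vector_mult_diff_distrib matrix_vector_mult_scaleR BA
          matrix_vector_right_distrib)
  qed
  have resid: "\<bar>(?B *v f k) $ i\<bar> \<le> \<gamma> k * x k $ i" for k i
  proof -
    let ?N = "matrix_norm2 ?B"
    have N: "norm (?B *v u) \<le> ?N * norm u" for u
      unfolding matrix_norm2_def by (intro onorm matrix_vector_mul_bounded_linear)
    have "p \<noteq> 0" "?B *v p \<noteq> 0"
      using BA[of "?B *v p"] matrix_inv_right[OF A] positive_vec_nonzero[OF p_positive]
      by (auto simp: matrix_vector_mul_assoc dest: arg_cong[of _ _ "(*v) A"])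
    then have "0 < ?N" using N[of p] by (simp add: norm_p) (metis less_le_trans zero_less_norm_iff)
    \<comment> \<open>The norm of \<open>B\<close> cancels the factor \<open>sep0 A\<close> of the residual bound.\<close>
    have "\<bar>(?B *v f k) $ i\<bar> \<le> ?N * norm (f k)"
      using component_le_norm_cart N by (rule order_trans)
    also have "\<dots> \<le> ?N * (\<gamma> k * sep0 A * min_entry (x k))"
      using ini \<open>0 < ?N\<close> by (intro mult_left_mono) auto
    also have "\<dots> = \<gamma> k * min_entry (x k)" using \<open>0 < ?N\<close> by (simp add: sep0_def)
    also have "\<dots> \<le> \<gamma> k * x k $ i"
      using assms(3) by (intro mult_left_mono) (auto simp: min_entry_def)
    finally show ?thesis .
  qed
  interpret N: inexact_Noda ?B r p w \<gamma> lam \<gamma>max x y "\<lambda>k. ?B *v f k"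
    using assms(3-5,7,8) ini step resid
    by unfold_locales (auto simp: spectral_radius_eq perron_vector_eq)
  have error: "noda_error A lam = N.eps"
    by (simp add: fun_eq_iff noda_error_def N.eps_def spectral_radius_eq)
  have ratio: "noda_ratio A \<gamma> lam x y = N.ratio"
    by (simp add: fun_eq_iff noda_ratio_def N.ratio_def N.v_def error)
  have bound: "2 * s / (1 + s) < 1" if "0 \<le> s" "s < 1" for s :: real
    using that by simp
  have "0 \<le> \<gamma>max" using assms(3,4) order_trans by blast
  then show ?thesis
    unfolding error ratio
    using N.eps_Suc N.ratio_less_1 bound N.g_less assms(3,5) N.limsup_ratio_minus_bound
      N.limsup_ratio N.ratio_tendsto_0 by blast
qed

end
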